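(* Let $\mathbf{A}_\bullet$ be a (finite-dimensional) representation of a (finite) quiver $Q=(s,t:E\to V)$. Let $Q^*$ be the acyclic reduction of $Q$ and $\mathbf{A}^*_\bullet$ the acyclification of $\mathbf{A}_\bullet$, with respect to any choice of ear decompositions (and roots) of the maximal strongly connected subquivers of $Q$. Let $Q^+$ be the augmented quiver of $Q^*$ with root $\rho$, let $T^+\subset Q^+$ be any spanning arborescence with root $\rho$, and let $\mathbf{A}^+_\bullet$ be the arboreal replacement of $\mathbf{A}^*_\bullet$, a representation of $T^+$. Then the space of sections $\Gamma(Q;\mathbf{A}_\bullet)\subset \mathrm{Tot}(\mathbf{A}_\bullet)$ is the image of the linear map $$F:\mathbf{A}^+_\rho\longrightarrow \mathrm{Tot}(\mathbf{A}_\bullet),\qquad F(x)_v=\mathbf{A}^+_{p[v]}(x)\in \mathbf{A}^+_v\subset \mathbf{A}_v\quad (v\in V),$$ where $p[v]$ is the unique path in $T^+$ from $\rho$ to $v$.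
   Context: **Quivers and sections.** A quiver $Q=(s,t:E\to V)$ consists of finite sets $V$ (vertices) and $E$ (edges) and maps $s,t:E\to V$ (source, target). A representation $\mathbf{A}_\bullet$ of $Q$ (over a fixed field) assigns a finite-dimensional vector space $\mathbf{A}_v$ to each $v\in V$ and a linear map $\mathbf{A}_e:\mathbf{A}_{s(e)}\to\mathbf{A}_{t(e)}$ to each $e\in E$. Put $\mathrm{Tot}(\mathbf{A}_\bullet)=\prod_{v\in V}\mathbf{A}_v$. A section is $\gamma=(\gamma_v)_{v}\in\mathrm{Tot}(\mathbf{A}_\bullet)$ with $\gamma_{t(e)}=\mathbf{A}_e(\gamma_{s(e)})$ for all $e\in E$; $\Gamma(Q;\mathbf{A}_\bullet)$ is the subspace of sections. A path is a sequence $p=(e_1,\dots,e_k)$, $k\ge1$, of edges with pairwise distinct sources and $s(e_{i+1})=t(e_i)$; $s(p)=s(e_1)$, $t(p)=t(e_k)$, $\mathbf{A}_p=\mathbf{A}_{e_k}\circ\cdots\circ\mathbf{A}_{e_1}$. It is a cycle if $s(p)=t(p)$; $Q$ is acyclic if it has no cycles. A subquiver is given by subsets of $V$ and $E$ closed under $s,t$. An arborescence with root $\rho$ is a rooted directed tree: no edge has target $\rho$, and each vertex $v\ne\rho$ is reached from $\rho$ by a unique path. **Ear decompositions.** $Q$ is strongly connected if for all vertices $v,v'$ there is a path from $v$ to $v'$. An ear decomposition of a strongly connected quiver $R=(s,t:E_R\to V_R)$ is an ordered sequence $R_\bullet=(R_1,\dots,R_c)$, $c\ge1$, of subquivers with vertex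 sets $V_i$ and edge sets $E_i$ such that: (1) the $E_i$ partition $E_R$ (and the $V_i$ cover $V_R$); (2) $R_1$ is a single vertex or a cycle, and each $R_i$ with $i>1$ is a (possibly cyclic) path, with no repeated vertices except that its source $s(R_i)$ and target $t(R_i)$ may coincide; (3) for $i>1$, $V_i\cap\bigcup_{j<i}V_j=\{s(R_i),t(R_i)\}$, of cardinality $1$ if $R_i$ is a cycle and $2$ otherwise. Fix a root $\rho(R)\in V_1$; if $R_1$ is a cycle, regard it as starting and ending at $\rho(R)$. The $i$-th terminal edge is the edge of $R_i$ with target $t(R_i)$ (for $i=1$ it does not exist if $R_1$ has no edges); $E_{\rm ter}(R_\bullet)$ is the set of terminal edges. The subquiver $T(R_\bullet)$ with vertices $V_R$ and edges $E_R\setminus E_{\rm ter}(R_\bullet)$ is an arborescence with root $\rho(R)$. Write $q[v]$ for the unique path in $T(R_\bullet)$ from $\rho(R)$ to $v$, with $\mathbf{A}_{q[\rho(R)]}=\mathrm{id}$. Put $$\mathbf{A}^R_{\rho(R)}:=\bigcap_{\epsilon\in E_{\rm ter}(R_\bullet)}\ker\left(\mathbf{A}_{q[t(\epsilon)]}-\mathbf{A}_\epsilon\circ\mathbf{A}_{q[s(\epsilon)]}\right)\subset\mathbf{A}_{\rho(R)}.$$ **Acyclic reduction and acyclification.** Let $\mathrm{MSC}(Q)$ be the set of maximal strongly connected subquivers of $Q$ (they are pairwise vertex-disjoint); fix an ear decomposition $R_\bullet$ and root for each. The acyclic reduction $Q^*$ has vertex set $V$ and edge set $E^*=E\setminus\bigcup_R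 E_{\rm ter}(R_\bullet)$; it is acyclic. For $v\in V$ let $\mathbf{A}^\circ_v=\mathbf{A}^R_{v}$ if $v=\rho(R)$ for some $R\in\mathrm{MSC}(Q)$, and $\mathbf{A}^\circ_v=\mathbf{A}_v$ otherwise. For $R\in\mathrm{MSC}(Q)$ let $$\Lambda_{v,R}=\{x\in\mathbf{A}^\circ_v\mid \mathbf{A}_p(x)\in\mathbf{A}^R_{\rho(R)}\text{ for every path }p\text{ in }Q^*\text{ from }v\text{ to }\rho(R)\},$$ (equal to $\mathbf{A}^\circ_v$ if there is no such path), and $\Lambda_v=\bigcap_R\Lambda_{v,R}$ (equal to $\mathbf{A}_v$ if $\mathrm{MSC}(Q)=\emptyset$). For $e\in E^*$, $\mathbf{A}_e$ maps $\Lambda_{s(e)}$ into $\Lambda_{t(e)}$. The acyclification $\mathbf{A}^*_\bullet$ is the representation of $Q^*$ with $\mathbf{A}^*_v=\Lambda_v$ and $\mathbf{A}^*_e=\mathbf{A}_e|_{\Lambda_{s(e)}}:\Lambda_{s(e)}\to\Lambda_{t(e)}$. **Augmentation, flow spaces, arboreal replacement.** Let $P$ be an acyclic quiver with vertices $V$, edges $E_P$ and representation $\mathbf{B}_\bullet$ (applied here with $P=Q^*$, $\mathbf{B}_\bullet=\mathbf{A}^*_\bullet$). Let $V_{\min}$ be the set of vertices that are not the target of any edge. The augmented quiver $P^+$ has vertices $V\cup\{\rho\}$ with $\rho$ new, and edges $E_P\cup\{e_v\mid v\in V_{\min}\}$ with $s(e_v)=\rho$, $t(e_v)=v$. Extend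 $\mathbf{B}_\bullet$ to $P^+$ by $\mathbf{B}_\rho=\prod_{v\in V_{\min}}\mathbf{B}_v$ and $\mathbf{B}_{e_v}$ = the canonical projection. Define inductively along paths, for each vertex $v$ of $P^+$, a subspace $\Phi_v\subset\mathbf{B}_\rho$ and a linear map $\phi_v:\Phi_v\to\mathbf{B}_v$: $\Phi_\rho=\mathbf{B}_\rho$, $\phi_\rho=\mathrm{id}$; for $v\ne\rho$, with $E_{\rm in}(v)$ the set of edges of $P^+$ with target $v$, let $\Phi'_v=\bigcap_{e\in E_{\rm in}(v)}\Phi_{s(e)}$, let $\Phi_v$ be the subspace of those $x\in\Phi'_v$ for which $\mathbf{B}_e(\phi_{s(e)}(x))$ is the same for all $e\in E_{\rm in}(v)$, and let $\phi_v(x)$ be this common value. Put $\Phi(\mathbf{B}_\bullet)=\bigcap_{v\in V}\Phi_v$. A spanning arborescence $T^+\subset P^+$ with root $\rho$ is a subquiver containing all vertices of $P^+$ which is an arborescence with root $\rho$. The arboreal replacement $\mathbf{B}^+_\bullet$ is the representation of $T^+$ with $\mathbf{B}^+_v=\mathbf{B}_v$ for $v\neq\rho$, $\mathbf{B}^+_\rho=\Phi(\mathbf{B}_\bullet)$, $\mathbf{B}^+_e=\mathbf{B}_e$ if $s(e)\ne\rho$ and $\mathbf{B}^+_e=\mathbf{B}_e|_{\Phi(\mathbf{B}_\bullet)}$ if $s(e)=\rho$. The arboreal replacement of $\mathbf{A}^*_\bullet$ is denoted $\mathbf{A}^+_\bullet$; thus $\mathbf{A}^+_v=\mathbf{A}^*_v\subset\mathbf{A}_v$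 for $v\in V$. *)

theory Defs
  imports
    "Graph_Theory.Graph_Theory"
    "HOL-Library.Function_Algebras"
    "HOL-Library.Product_Plus"
begin

section \<open>Quivers\<close>

text \<open>
  A quiver is a \<^typ>\<open>('v, 'e) pre_digraph\<close> satisfying \<^const>\<open>fin_digraph\<close> (loops and multiple
  arcs are allowed); a subquiver is a \<^const>\<open>subgraph\<close>.  A path has at least one edge and
  pairwise distinct sources, but its target may be one of these sources.
\<close>

definition qpath :: "('v, 'e) pre_digraph \<Rightarrow> 'v \<Rightarrow> 'e list \<Rightarrow> 'v \<Rightarrow> bool" where
  "qpath Q u p v \<longleftrightarrow> pre_digraph.awalk Q u p v \<and> p \<noteq> [] \<and> distinct (map (tail Q) p)"

definition arborescence :: "('v, 'e) pre_digraph \<Rightarrow> 'v \<Rightarrow> bool" where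
  "arborescence T r \<longleftrightarrow> wf_digraph T \<and> r \<in> verts T \<and> (\<forall>e\<in>arcs T. head T e \<noteq> r) \<and>
     (\<forall>v\<in>verts T. v \<noteq> r \<longrightarrow> (\<exists>!p. qpath T r p v))"

definition root_path :: "('v, 'e) pre_digraph \<Rightarrow> 'v \<Rightarrow> 'v \<Rightarrow> 'e list" where
  "root_path T r v = (if v = r then [] else (THE p. qpath T r p v))"

text \<open>
  Since paths are nonempty, a vertex lying on no cycle does not form a strongly connected
  quiver, in contrast to \<^const>\<open>strongly_connected\<close>.
\<close>

definition qstrongly_connected :: "('v, 'e) pre_digraph \<Rightarrow> bool" where
  "qstrongly_connected R \<longleftrightarrow> verts R \<noteq> {} \<and> (\<forall>u\<in>verts R. \<forall>v\<in>verts R. \<exists>p. qpath R u p v)"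

definition MSC :: "('v, 'e) pre_digraph \<Rightarrow> ('v, 'e) pre_digraph set" where
  "MSC Q = {R. pre_digraph.max_subgraph Q qstrongly_connected R}"


section \<open>Ear decompositions\<close>

text \<open>\<open>H\<close> consists exactly of the edges and vertices of a path from \<open>u\<close> to \<open>v\<close> whose vertices
  are pairwise distinct, except that \<open>u = v\<close> is allowed (the path is then a cycle).\<close>

definition path_quiver :: "('v, 'e) pre_digraph \<Rightarrow> 'v \<Rightarrow> 'v \<Rightarrow> bool" where
  "path_quiver H u v \<longleftrightarrow> (\<exists>p. qpath H u p v \<and> (v = u \<or> v \<notin> tail H ` set p) \<and>
     arcs H = set p \<and> verts H = tail H ` set p \<union> head H ` set p)"

text \<open>The \<open>i\<close>-th ear (counted from 0, with \<open>i > 0\<close>) has source \<open>u\<close> and target \<open>v\<close>.  For a cyclic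
  ear it is the intersection condition that singles out its source.\<close>

definition ear_at :: "('v, 'e) pre_digraph list \<Rightarrow> nat \<Rightarrow> 'v \<Rightarrow> 'v \<Rightarrow> bool" where
  "ear_at Rs i u v \<longleftrightarrow> path_quiver (Rs ! i) u v \<and>
     verts (Rs ! i) \<inter> (\<Union>j<i. verts (Rs ! j)) = {u, v}"

definition ear_decomposition ::
    "('v, 'e) pre_digraph \<Rightarrow> ('v, 'e) pre_digraph list \<Rightarrow> bool" where
  "ear_decomposition R Rs \<longleftrightarrow> Rs \<noteq> [] \<and>
     (\<forall>i<length Rs. subgraph (Rs ! i) R) \<and>
     (\<Union>i<length Rs. arcs (Rs ! i)) = arcs R \<and>
     (\<forall>i<length Rs. \<forall>j<length Rs. i \<noteq> j \<longrightarrow> arcs (Rs ! i) \<inter> arcs (Rs ! j) = {}) \<and>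
     (\<Union>i<length Rs. verts (Rs ! i)) = verts R \<and>
     ((\<exists>v. verts (Rs ! 0) = {v} \<and> arcs (Rs ! 0) = {}) \<or> (\<exists>v. path_quiver (Rs ! 0) v v)) \<and>
     (\<forall>i. 0 < i \<and> i < length Rs \<longrightarrow> (\<exists>u v. ear_at Rs i u v))"

definition terminal_edges :: "('v, 'e) pre_digraph list \<Rightarrow> 'v \<Rightarrow> 'e set" where
  "terminal_edges Rs r = {e \<in> arcs (Rs ! 0). head (Rs ! 0) e = r} \<union>
     {e. \<exists>i u v. 0 < i \<and> i < length Rs \<and> ear_at Rs i u v \<and>
           e \<in> arcs (Rs ! i) \<and> head (Rs ! i) e = v}"

definition ear_tree ::
    "('v, 'e) pre_digraph \<Rightarrow> ('v, 'e) pre_digraph list \<Rightarrow> 'v \<Rightarrow> ('v, 'e) pre_digraph" where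
  "ear_tree R Rs r = R\<lparr>arcs := arcs R - terminal_edges Rs r\<rparr>"

text \<open>A simultaneous choice of ear decompositions and roots for all members of \<open>MSC Q\<close>.\<close>

definition ear_choice ::
    "('v, 'e) pre_digraph \<Rightarrow> (('v, 'e) pre_digraph \<Rightarrow> ('v, 'e) pre_digraph list) \<Rightarrow>
     (('v, 'e) pre_digraph \<Rightarrow> 'v) \<Rightarrow> bool" where
  "ear_choice Q ears rt \<longleftrightarrow>
     (\<forall>R\<in>MSC Q. ear_decomposition R (ears R) \<and> rt R \<in> verts (ears R ! 0))"

definition acyclic_reduction ::
    "('v, 'e) pre_digraph \<Rightarrow> (('v, 'e) pre_digraph \<Rightarrow> ('v, 'e) pre_digraph list) \<Rightarrow>
     (('v, 'e) pre_digraph \<Rightarrow> 'v) \<Rightarrow> ('v, 'e) pre_digraph" where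
  "acyclic_reduction Q ears rt =
     Q\<lparr>arcs := arcs Q - (\<Union>R\<in>MSC Q. terminal_edges (ears R) (rt R))\<rparr>"


section \<open>Representations and sections\<close>

text \<open>
  All spaces of a representation are subspaces of one ambient vector space \<open>'b\<close>, with scalar
  multiplication \<open>s\<close>; this is no restriction up to isomorphism, as the direct sum of the spaces
  can serve as ambient space.  Edge maps are only meaningful on the space at their source, so
  that \<open>rep_map A\<close> also denotes the restriction of the edge maps to smaller spaces.
\<close>

record ('v, 'e, 'b) quiver_rep =
  rep_space :: "'v \<Rightarrow> 'b set"
  rep_map :: "'e \<Rightarrow> 'b \<Rightarrow> 'b"

definition linear_between ::
    "('k::field \<Rightarrow> 'b::ab_group_add \<Rightarrow> 'b) \<Rightarrow> ('k \<Rightarrow> 'c::ab_group_add \<Rightarrow> 'c) \<Rightarrow>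
     'b set \<Rightarrow> 'c set \<Rightarrow> ('b \<Rightarrow> 'c) \<Rightarrow> bool" where
  "linear_between s1 s2 U W f \<longleftrightarrow> module.subspace s1 U \<and> module.subspace s2 W \<and> f ` U \<subseteq> W \<and>
     (\<forall>x\<in>U. \<forall>y\<in>U. f (x + y) = f x + f y) \<and> (\<forall>c. \<forall>x\<in>U. f (s1 c x) = s2 c (f x))"

definition representation ::
    "('k::field \<Rightarrow> 'b::ab_group_add \<Rightarrow> 'b) \<Rightarrow> ('v, 'e) pre_digraph \<Rightarrow>
     ('v, 'e, 'b) quiver_rep \<Rightarrow> bool" where
  "representation s Q A \<longleftrightarrow>
     (\<forall>v\<in>verts Q. \<exists>B. finite B \<and> rep_space A v = module.span s B) \<and>
     (\<forall>e\<in>arcs Q. linear_between s s (rep_space A (tail Q e)) (rep_space A (head Q e))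
                    (rep_map A e))"

abbreviation path_map :: "('v, 'e, 'b) quiver_rep \<Rightarrow> 'e list \<Rightarrow> 'b \<Rightarrow> 'b" where
  "path_map A p \<equiv> fold (rep_map A) p"

text \<open>The product of the subspaces \<open>S i\<close> for \<open>i \<in> I\<close>; families vanish outside of \<open>I\<close>, so that the
  product is a subspace of the pointwise vector space of functions.\<close>

definition prod_space :: "'i set \<Rightarrow> ('i \<Rightarrow> 'b::zero set) \<Rightarrow> ('i \<Rightarrow> 'b) set" where
  "prod_space I S = {f. (\<forall>i\<in>I. f i \<in> S i) \<and> (\<forall>i. i \<notin> I \<longrightarrow> f i = 0)}"

definition fun_scale :: "('k \<Rightarrow> 'b \<Rightarrow> 'b) \<Rightarrow> 'k \<Rightarrow> ('i \<Rightarrow> 'b) \<Rightarrow> 'i \<Rightarrow> 'b" where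
  "fun_scale s c f = (\<lambda>i. s c (f i))"

definition Tot :: "('v, 'e) pre_digraph \<Rightarrow> ('v, 'e, 'b::zero) quiver_rep \<Rightarrow> ('v \<Rightarrow> 'b) set" where
  "Tot Q A = prod_space (verts Q) (rep_space A)"

definition rep_sections ::
    "('v, 'e) pre_digraph \<Rightarrow> ('v, 'e, 'b::zero) quiver_rep \<Rightarrow> ('v \<Rightarrow> 'b) set" where
  "rep_sections Q A =
     {\<gamma> \<in> Tot Q A. \<forall>e\<in>arcs Q. \<gamma> (head Q e) = rep_map A e (\<gamma> (tail Q e))}"


section \<open>Acyclification\<close>

definition ear_space ::
    "('v, 'e, 'b::ab_group_add) quiver_rep \<Rightarrow> ('v, 'e) pre_digraph \<Rightarrow>
     ('v, 'e) pre_digraph list \<Rightarrow> 'v \<Rightarrow> 'b set" where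
  "ear_space A R Rs r =
     {x \<in> rep_space A r. \<forall>e\<in>terminal_edges Rs r.
        path_map A (root_path (ear_tree R Rs r) r (head R e)) x
        - rep_map A e (path_map A (root_path (ear_tree R Rs r) r (tail R e)) x) = 0}"

text \<open>The members of \<open>MSC Q\<close> are vertex-disjoint, so \<open>v\<close> is the root of at most one of them.\<close>

definition circ_space ::
    "('v, 'e) pre_digraph \<Rightarrow> (('v, 'e) pre_digraph \<Rightarrow> ('v, 'e) pre_digraph list) \<Rightarrow>
     (('v, 'e) pre_digraph \<Rightarrow> 'v) \<Rightarrow> ('v, 'e, 'b::ab_group_add) quiver_rep \<Rightarrow> 'v \<Rightarrow> 'b set" where
  "circ_space Q ears rt A v =
     (if \<exists>R\<in>MSC Q. v = rt R
      then (let R = (THE R. R \<in> MSC Q \<and> v = rt R) in ear_space A R (ears R) v)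
      else rep_space A v)"

definition Lambda_comp ::
    "('v, 'e) pre_digraph \<Rightarrow> (('v, 'e) pre_digraph \<Rightarrow> ('v, 'e) pre_digraph list) \<Rightarrow>
     (('v, 'e) pre_digraph \<Rightarrow> 'v) \<Rightarrow> ('v, 'e, 'b::ab_group_add) quiver_rep \<Rightarrow>
     'v \<Rightarrow> ('v, 'e) pre_digraph \<Rightarrow> 'b set" where
  "Lambda_comp Q ears rt A v R =
     {x \<in> circ_space Q ears rt A v.
        \<forall>p. qpath (acyclic_reduction Q ears rt) v p (rt R) \<longrightarrow>
            path_map A p x \<in> ear_space A R (ears R) (rt R)}"

definition Lambda ::
    "('v, 'e) pre_digraph \<Rightarrow> (('v, 'e) pre_digraph \<Rightarrow> ('v, 'e) pre_digraph list) \<Rightarrow>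
     (('v, 'e) pre_digraph \<Rightarrow> 'v) \<Rightarrow> ('v, 'e, 'b::ab_group_add) quiver_rep \<Rightarrow> 'v \<Rightarrow> 'b set" where
  "Lambda Q ears rt A v =
     (if MSC Q = {} then rep_space A v else (\<Inter>R\<in>MSC Q. Lambda_comp Q ears rt A v R))"

definition acyclification ::
    "('v, 'e) pre_digraph \<Rightarrow> (('v, 'e) pre_digraph \<Rightarrow> ('v, 'e) pre_digraph list) \<Rightarrow>
     (('v, 'e) pre_digraph \<Rightarrow> 'v) \<Rightarrow> ('v, 'e, 'b::ab_group_add) quiver_rep \<Rightarrow>
     ('v, 'e, 'b) quiver_rep" where
  "acyclification Q ears rt A =
     \<lparr>rep_space = Lambda Q ears rt A, rep_map = rep_map A\<rparr>"


section \<open>Augmentation, flow spaces and arboreal replacement\<close>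

definition min_verts :: "('v, 'e) pre_digraph \<Rightarrow> 'v set" where
  "min_verts P = {v \<in> verts P. \<forall>e\<in>arcs P. head P e \<noteq> v}"

text \<open>The new vertex is \<^const>\<open>None\<close>, and \<open>Inr v\<close> is the new edge to the minimal vertex \<open>v\<close>.\<close>

definition augment :: "('v, 'e) pre_digraph \<Rightarrow> ('v option, 'e + 'v) pre_digraph" where
  "augment P =
     \<lparr>verts = insert None (Some ` verts P),
      arcs = Inl ` arcs P \<union> Inr ` min_verts P,
      tail = case_sum (\<lambda>e. Some (tail P e)) (\<lambda>v. None),
      head = case_sum (\<lambda>e. Some (head P e)) Some\<rparr>"

text \<open>
  The root space consists of families in \<open>'v \<Rightarrow> 'b\<close>, whereas the other spaces lie in \<open>'b\<close>.  The
  extended representation therefore takes its values in the direct sum \<open>('v \<Rightarrow> 'b) \<times> 'b\<close>: the root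
  space sits in the first summand, all others in the second.
\<close>

definition aug_scale ::
    "('k \<Rightarrow> 'b \<Rightarrow> 'b) \<Rightarrow> 'k \<Rightarrow> ('v \<Rightarrow> 'b) \<times> 'b \<Rightarrow> ('v \<Rightarrow> 'b) \<times> 'b" where
  "aug_scale s c z = (fun_scale s c (fst z), s c (snd z))"

definition augment_rep ::
    "('v, 'e) pre_digraph \<Rightarrow> ('v, 'e, 'b::ab_group_add) quiver_rep \<Rightarrow>
     ('v option, 'e + 'v, ('v \<Rightarrow> 'b) \<times> 'b) quiver_rep" where
  "augment_rep P B =
     \<lparr>rep_space = (\<lambda>w. case w of
         None \<Rightarrow> prod_space (min_verts P) (rep_space B) \<times> {0}
       | Some v \<Rightarrow> {0} \<times> rep_space B v),
      rep_map = case_sum (\<lambda>e z. (0, rep_map B e (snd z))) (\<lambda>v z. (0, fst z v))\<rparr>"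

text \<open>
  The pair of the flow space at \<open>w\<close> and the flow map at \<open>w\<close>, by recursion along the edges of the
  augmented quiver; the recursion is well-founded if \<open>P\<close> is finite and acyclic.
\<close>

definition flow ::
    "('v, 'e) pre_digraph \<Rightarrow> ('v, 'e, 'b::ab_group_add) quiver_rep \<Rightarrow> 'v option \<Rightarrow>
     (('v \<Rightarrow> 'b) \<times> 'b) set \<times> (('v \<Rightarrow> 'b) \<times> 'b \<Rightarrow> ('v \<Rightarrow> 'b) \<times> 'b)" where
  "flow P B = wfrec (arcs_ends (augment P))
     (\<lambda>rec w.
        if w = None then (rep_space (augment_rep P B) None, id)
        else
          let E_in = in_arcs (augment P) w;
              val = (\<lambda>e x. rep_map (augment_rep P B) e (snd (rec (tail (augment P) e)) x));
              \<Phi>' = (\<Inter>e\<in>E_in. fst (rec (tail (augment P) e)))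
          in ({x \<in> \<Phi>'. \<forall>e\<in>E_in. \<forall>e'\<in>E_in. val e x = val e' x},
              (\<lambda>x. THE y. \<forall>e\<in>E_in. val e x = y)))"

definition flow_space ::
    "('v, 'e) pre_digraph \<Rightarrow> ('v, 'e, 'b::ab_group_add) quiver_rep \<Rightarrow>
     (('v \<Rightarrow> 'b) \<times> 'b) set" where
  "flow_space P B =
     {x \<in> rep_space (augment_rep P B) None. \<forall>v\<in>verts P. x \<in> fst (flow P B (Some v))}"

definition spanning_arborescence ::
    "('v, 'e) pre_digraph \<Rightarrow> ('v, 'e) pre_digraph \<Rightarrow> 'v \<Rightarrow> bool" where
  "spanning_arborescence T Q r \<longleftrightarrow> spanning T Q \<and> arborescence T r"

definition arboreal_replacement ::
    "('v, 'e) pre_digraph \<Rightarrow> ('v, 'e, 'b::ab_group_add) quiver_rep \<Rightarrow>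
     ('v option, 'e + 'v, ('v \<Rightarrow> 'b) \<times> 'b) quiver_rep" where
  "arboreal_replacement P B =
     \<lparr>rep_space = (rep_space (augment_rep P B))(None := flow_space P B),
      rep_map = rep_map (augment_rep P B)\<rparr>"

end

theory Submission
  imports Defs
begin

text \<open>
  The sections of \<open>Q\<close>, the sections of its acyclic reduction and the flow space are in bijection.

  \<open>Q\<close> with \<open>A\<close> and its acyclic reduction with the acyclification have the same sections
  (\<open>rep_sections_acyclification\<close>).  The edges removed are the terminal edges of the ear
  decompositions.  Inside a maximal strongly connected subquiver \<open>R\<close>, the other edges form an
  arborescence (\<open>ear_tree_arborescence\<close>), so that a family compatible with them is determined on \<open>R\<close>
  by its value at the root.  Compatibility with the removed edges becomes a condition on this
  value alone, namely membership in the ear space; the spaces of the acyclification impose this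
  condition at the roots and pull it back along all paths to them.

  The reduction is acyclic (\<open>acyclic_Qred\<close>): a cycle of \<open>Q\<close> is contained in a single
  maximal strongly connected subquiver, and within it in an ear tree if it avoids the terminal
  edges.

  On a finite acyclic quiver, a point of the flow space is a choice of values at the minimal
  vertices whose propagation along edges is consistent, and the propagated values form a section.
  So restriction to the minimal vertices is a bijection from sections onto the flow space
  (\<open>flow_space_eq\<close>).  The map \<open>F\<close> of the theorem propagates along the chosen spanning arborescence
  only, which for a consistent choice gives the same values; it is the inverse of
  this restriction (\<open>spanning_arborescence_path_map\<close>).  Being inverse to a linear bijection, it is
  linear, and its image is the space of sections.
\<close>

section \<open>Walks and paths\<close>

lemma cas_append_ex:
  "pre_digraph.cas G u (p @ q) v \<longleftrightarrow> (\<exists>w. pre_digraph.cas G u p w \<and> pre_digraph.cas G w q v)"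
  by (induction p arbitrary: u) (auto simp: pre_digraph.cas.simps)

lemma (in wf_digraph) awalk_append_ex:
  "awalk u (p @ q) v \<longleftrightarrow> (\<exists>w. awalk u p w \<and> awalk w q v)"
proof
  assume "awalk u (p @ q) v"
  then show "\<exists>w. awalk u p w \<and> awalk w q v" by auto
next
  assume "\<exists>w. awalk u p w \<and> awalk w q v"
  then show "awalk u (p @ q) v" by (auto simp: awalk_def cas_append_ex)
qed

lemma (in wf_digraph) ex_qpath_iff_reachable1: "(\<exists>p. qpath G u p v) \<longleftrightarrow> u \<rightarrow>\<^sup>+ v"
proof
  assume "u \<rightarrow>\<^sup>+ v"
  then obtain p where "awalk u p v" "p \<noteq> []" by (auto simp: reachable1_awalk)
  then show "\<exists>p. qpath G u p v"
  proof (induction "length p" arbitrary: p rule: less_induct)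
    case less
    show ?case
    proof (cases "distinct (map (tail G) p)")
      case True
      with less.prems show ?thesis by (auto simp: qpath_def)
    next
      case False
      \<comment> \<open>cut out the closed walk between two arcs with the same source\<close>
      then obtain a e b e' c where p: "p = a @ e # b @ e' # c" and "tail G e = tail G e'"
        by (auto dest!: not_distinct_decomp
            simp: map_eq_append_conv map_eq_Cons_conv Cons_eq_map_conv append_eq_map_conv)
      with less.prems have "awalk u (a @ e' # c) v"
        by (auto simp: awalk_append_ex awalk_Cons_iff)
      with less.hyps[of "a @ e' # c"] p show ?thesis by simp
    qed
  qed
qed (auto simp: qpath_def reachable1_awalk)

text \<open>
  A repeated source would cut out a closed walk.  In an acyclic quiver, all nonempty walks are
  therefore paths, so that paths can be concatenated without care for repeated sources.
\<close>

lemma (in wf_digraph) distinct_tails_if_acyclic: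
  assumes "acyclic (arcs_ends G)" and "awalk u p v"
  shows "distinct (map (tail G) p)"
  using assms(2)
proof (induction p arbitrary: u)
  case (Cons e p)
  have "tail G e \<noteq> tail G e'" if "e' \<in> set p" for e'
  proof
    assume eq: "tail G e = tail G e'"
    from that obtain a c where "p = a @ e' # c" by (auto simp: in_set_conv_decomp)
    with Cons.prems eq have "awalk (tail G e) (e # a) (tail G e)"
      by (auto simp: awalk_append_ex awalk_Cons_iff)
    then have "(tail G e, tail G e) \<in> (arcs_ends G)\<^sup>+"
      using reachable1_awalkI by blast
    with assms(1) show False by (simp add: acyclic_def)
  qed
  with Cons show ?case by (auto simp: awalk_Cons_iff)
qed simp

text \<open>
  The only way in which sections enter the proof: a compatible family is transported along every
  walk.  It is applied to the acyclic reduction, to the ear trees, and to the arborescence in the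
  augmented quiver.
\<close>

lemma path_map_section:
  assumes "\<forall>e\<in>arcs G. g (head G e) = rep_map A e (g (tail G e))"
    and "pre_digraph.awalk G u p v"
  shows "path_map A p (g u) = g v"
proof -
  from assms(2) have "set p \<subseteq> arcs G" "pre_digraph.cas G u p v"
    by (auto simp: pre_digraph.awalk_def)
  then show ?thesis
  proof (induction p arbitrary: u)
    case (Cons e p)
    then show ?case using assms(1)[rule_format, of e, symmetric] by (auto simp: pre_digraph.cas.simps)
  qed (simp add: pre_digraph.cas.simps)
qed

section \<open>A criterion for arborescences\<close>

text \<open>
  A vertex \<open>z\<close> with an arc \<open>y \<rightarrow> z\<close> can lie on a cycle only if \<open>y\<close> does, because that arc is the only
  one into \<open>z\<close>.  As the root lies on no cycle, neither does anything reachable from it.  Since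
  the root has no incoming arc, a walk from it can moreover be recovered from its end, reading
  backwards along the unique incoming arcs.
\<close>

lemma arborescence_if_unique_in_arc:
  assumes wf: "wf_digraph T" and r: "r \<in> verts T"
    and no_in: "\<forall>e\<in>arcs T. head T e \<noteq> r"
    and inj: "inj_on (head T) (arcs T)"
    and reach: "\<forall>v\<in>verts T. (r, v) \<in> (arcs_ends T)\<^sup>*"
  shows "acyclic (arcs_ends T)" and "arborescence T r"
proof -
  interpret wf_digraph T by (rule wf)
  \<comment> \<open>not being on a cycle propagates along the walks that start at the root\<close>
  have noncyc: "(v, v) \<notin> (arcs_ends T)\<^sup>+" if "(r, v) \<in> (arcs_ends T)\<^sup>*" for v
    using that
  proof (induction rule: rtrancl_induct)
    case base
    show ?case
    proof
      assume "(r, r) \<in> (arcs_ends T)\<^sup>+"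
      then obtain z where "(z, r) \<in> arcs_ends T" by (auto elim: tranclE)
      with no_in show False by (auto simp: arcs_ends_conv)
    qed
  next
    case (step y z)
    show ?case
    proof
      assume "(z, z) \<in> (arcs_ends T)\<^sup>+"
      then obtain w where w: "(z, w) \<in> (arcs_ends T)\<^sup>*" "(w, z) \<in> arcs_ends T"
        by (auto dest: tranclD2)
      with step.hyps inj have "w = y" by (auto simp: arcs_ends_conv dest: inj_onD)
      with w step.hyps have "(y, y) \<in> (arcs_ends T)\<^sup>+" by (meson rtrancl_into_trancl2)
      with step.IH show False by blast
    qed
  qed
  show ac: "acyclic (arcs_ends T)"
    unfolding acyclic_def using noncyc reach reachable1_in_verts by blast
  have unique: "p = p'" if "awalk r p v" "awalk r p' v" for p p' v
    using that
  proof (induction p arbitrary: p' v rule: rev_induct)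
    case Nil
    then have "v = r" by (auto simp: awalk_Nil_iff)
    with Nil no_in show ?case
      by (cases p' rule: rev_cases) (auto simp: awalk_append_ex awalk_Cons_iff awalk_Nil_iff)
  next
    case (snoc e p)
    then have e: "e \<in> arcs T" "head T e = v" "awalk r p (tail T e)"
      by (auto simp: awalk_append_ex awalk_Cons_iff awalk_Nil_iff)
    with no_in have "v \<noteq> r" by auto
    with snoc.prems(2) obtain e' q where p': "p' = q @ [e']" "e' \<in> arcs T" "head T e' = v"
      "awalk r q (tail T e')"
      by (cases p' rule: rev_cases) (auto simp: awalk_append_ex awalk_Cons_iff awalk_Nil_iff)
    with e inj have "e' = e" by (auto dest: inj_onD)
    with snoc.IH e p' show ?case by auto
  qed
  show "arborescence T r"
    unfolding arborescence_def
  proof (intro conjI ballI impI)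
    fix v assume v: "v \<in> verts T" "v \<noteq> r"
    with reach have "(r, v) \<in> (arcs_ends T)\<^sup>+" by (metis rtranclD)
    then obtain p where "qpath T r p v" using ex_qpath_iff_reachable1 by blast
    then show "\<exists>!p. qpath T r p v" using unique by (auto simp: qpath_def)
  qed (use wf r no_in in auto)
qed

lemma root_path_awalk:
  assumes "arborescence T r" and "v \<in> verts T"
  shows "pre_digraph.awalk T r (root_path T r v) v"
proof (cases "v = r")
  case True
  then show ?thesis using assms
    by (auto simp: arborescence_def root_path_def pre_digraph.awalk_def pre_digraph.cas.simps)
next
  case False
  then have "\<exists>!p. qpath T r p v" using assms by (auto simp: arborescence_def)
  then have "qpath T r (THE p. qpath T r p v) v" by (rule theI')
  then show ?thesis using False by (simp add: root_path_def qpath_def)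
qed

section \<open>Ear decompositions\<close>

lemma cas_heads:
  assumes "pre_digraph.cas G u p v" and "p \<noteq> []"
  shows "map (head G) p = tl (map (tail G) p) @ [v]" and "tail G (hd p) = u"
proof -
  show "map (head G) p = tl (map (tail G) p) @ [v]"
    using assms
  proof (induction p arbitrary: u)
    case (Cons e p)
    then show ?case by (cases p) (auto simp: pre_digraph.cas.simps)
  qed simp
  show "tail G (hd p) = u" using assms by (cases p) (auto simp: pre_digraph.cas.simps)
qed

text \<open>
  Apart from the last one, the targets of a path are its sources other than the first one.  The
  last target is no source, or it is the first source, which is not among the other targets.
\<close>

lemma path_quiver_inj_head:
  assumes "path_quiver H u v"
  shows "inj_on (head H) (arcs H)"
proof -
  from assms obtain p where p: "qpath H u p v" "v = u \<or> v \<notin> tail H ` set p" "arcs H = set p"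
    by (auto simp: path_quiver_def)
  then have c: "pre_digraph.cas H u p v" and ne: "p \<noteq> []" and d: "distinct (map (tail H) p)"
    by (auto simp: qpath_def pre_digraph.awalk_def)
  note h = cas_heads[OF c ne]
  have "v \<notin> set (tl (map (tail H) p))"
  proof (cases "v = u")
    case True
    then show ?thesis using d h(2) ne by (cases p) auto
  next
    case False
    then show ?thesis using p(2) by (cases p) auto
  qed
  then have "distinct (map (head H) p)" unfolding h(1) using d by (simp add: distinct_tl)
  then show ?thesis using p(3) by (simp add: distinct_map)
qed

lemma path_quiver_source: "path_quiver H u v \<Longrightarrow> \<exists>e\<in>arcs H. tail H e = u"
  unfolding path_quiver_def qpath_def pre_digraph.awalk_def
  by (metis cas_heads(2) hd_in_set)

lemma path_quiver_target: "path_quiver H u v \<Longrightarrow> v = u \<or> v \<notin> tail H ` arcs H"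
  by (auto simp: path_quiver_def)

text \<open>
  The intersection of an ear with the earlier ones only determines the set of its two ends.  The
  source is the end at which an arc starts, so the terminal arc is well defined.
\<close>

lemma path_quiver_unique_ends:
  assumes "path_quiver H u v" "path_quiver H u' v'" "{u, v} = {u', v'}"
  shows "u = u' \<and> v = v'"
  using assms path_quiver_source[OF assms(1)] path_quiver_target[OF assms(1)]
    path_quiver_source[OF assms(2)] path_quiver_target[OF assms(2)]
  by (auto simp: doubleton_eq_iff)

text \<open>If the first ear is a cycle, any of its vertices may have been chosen as the root.\<close>

lemma path_quiver_rotate:
  assumes H: "path_quiver H v v" and r: "r \<in> verts H"
  shows "path_quiver H r r"
proof -
  from H obtain p where p: "qpath H v p v" "arcs H = set p"
      "verts H = tail H ` set p \<union> head H ` set p"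
    by (auto simp: path_quiver_def)
  then have c: "pre_digraph.cas H v p v" and ne: "p \<noteq> []" and d: "distinct (map (tail H) p)"
    by (auto simp: qpath_def pre_digraph.awalk_def)
  have "head H ` set p \<subseteq> tail H ` set p"
  proof -
    have "set (map (head H) p) \<subseteq> set (map (tail H) p)"
      unfolding cas_heads(1)[OF c ne] using cas_heads(2)[OF c ne] ne by (cases p) auto
    then show ?thesis by simp
  qed
  with r p(3) obtain e where "e \<in> set p" "tail H e = r" by auto
  then obtain a b where ab: "p = a @ e # b" by (auto simp: in_set_conv_decomp)
  let ?q = "e # b @ a"
  have "pre_digraph.cas H r ?q r"
    using c \<open>tail H e = r\<close> unfolding ab by (auto simp: cas_append_ex pre_digraph.cas.simps)
  moreover have "set ?q = set p" "distinct (map (tail H) ?q)" using d unfolding ab by auto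
  ultimately show ?thesis
    unfolding path_quiver_def qpath_def pre_digraph.awalk_def using p(2,3) r
    by (intro exI[of _ ?q]) auto
qed

lemma closed_along_walk:
  assumes "pre_digraph.cas G u p v" and "u \<in> X" and "v \<in> X"
    and "\<And>e. e \<in> set p \<Longrightarrow> tail G e \<in> X \<Longrightarrow> head G e \<noteq> v \<Longrightarrow> head G e \<in> X"
  shows "tail G ` set p \<union> head G ` set p \<subseteq> X"
  using assms
proof (induction p arbitrary: u)
  case (Cons e p)
  then have "tail G e \<in> X" "pre_digraph.cas G (head G e) p v"
    by (auto simp: pre_digraph.cas.simps)
  moreover from this(1) have "head G e \<in> X" using Cons.prems by (cases "head G e = v") auto
  ultimately show ?case using Cons.IH[of "head G e"] Cons.prems by auto
qed simp

lemma ear_tree_simps [simp]: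
  "verts (ear_tree R Rs r) = verts R" "arcs (ear_tree R Rs r) = arcs R - terminal_edges Rs r"
  "tail (ear_tree R Rs r) = tail R" "head (ear_tree R Rs r) = head R"
  by (simp_all add: ear_tree_def)

text \<open>
  The first ear is treated like the others: it is a closed path (or a single vertex) attached
  to the root alone.
  Each arc of an ear other than its terminal arc leads to a vertex that is neither the root nor on
  an earlier ear.  Therefore no two of these arcs share their target, and
  deleting the terminal arcs leaves an arborescence.
\<close>

locale rooted_ear_decomposition = wf_digraph R for R :: "('v, 'e) pre_digraph" +
  fixes Rs :: "('v, 'e) pre_digraph list" and r :: 'v
  assumes ears: "ear_decomposition R Rs" and root: "r \<in> verts (Rs ! 0)"
begin

definition previous :: "nat \<Rightarrow> 'v set" where
  "previous i = insert r (\<Union>j<i. verts (Rs ! j))"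

lemma ear_ends [simp]:
  assumes "i < length Rs"
  shows "tail (Rs ! i) = tail R" "head (Rs ! i) = head R"
  using ears assms by (auto simp: ear_decomposition_def subgraph_def compatible_def)

lemma ear_wf:
  assumes "i < length Rs" and "e \<in> arcs (Rs ! i)"
  shows "tail R e \<in> verts (Rs ! i)" "head R e \<in> verts (Rs ! i)"
proof -
  have "wf_digraph (Rs ! i)" using ears assms by (auto simp: ear_decomposition_def subgraph_def)
  from wf_digraph.tail_in_verts[OF this assms(2)] wf_digraph.head_in_verts[OF this assms(2)]
  show "tail R e \<in> verts (Rs ! i)" "head R e \<in> verts (Rs ! i)" using assms by auto
qed

lemma ear_disjoint:
  assumes "i < length Rs" "j < length Rs" "e \<in> arcs (Rs ! i)" "e \<in> arcs (Rs ! j)"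
  shows "i = j"
  using ears assms unfolding ear_decomposition_def by blast

text \<open>
  The uniform description of all ears having arcs, the first one included: for it, \<open>u = v = r\<close>.
\<close>

lemma ear_target:
  assumes i: "i < length Rs" and ne: "arcs (Rs ! i) \<noteq> {}"
  obtains u v where "path_quiver (Rs ! i) u v" "verts (Rs ! i) \<inter> previous i = {u, v}"
    "\<And>e. e \<in> arcs (Rs ! i) \<Longrightarrow> e \<in> terminal_edges Rs r \<longleftrightarrow> head R e = v"
proof (cases "i = 0")
  case True
  with ears ne obtain v where "path_quiver (Rs ! 0) v v" by (auto simp: ear_decomposition_def)
  then have "path_quiver (Rs ! 0) r r" using root by (rule path_quiver_rotate)
  moreover have "e \<in> terminal_edges Rs r \<longleftrightarrow> head R e = r" if "e \<in> arcs (Rs ! 0)" for e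
    using that ear_disjoint[of 0 _ e] i True by (auto simp: terminal_edges_def)
  ultimately show ?thesis using True root that[of r r] by (auto simp: previous_def)
next
  case False
  with i ears obtain u v where uv: "ear_at Rs i u v" by (auto simp: ear_decomposition_def)
  have unique: "v' = v" if "ear_at Rs i u' v'" for u' v'
    using uv that path_quiver_unique_ends[of "Rs ! i" u v u' v'] by (auto simp: ear_at_def)
  have "e \<in> terminal_edges Rs r \<longleftrightarrow> head R e = v" if e: "e \<in> arcs (Rs ! i)" for e
  proof
    assume "e \<in> terminal_edges Rs r"
    then consider "e \<in> arcs (Rs ! 0)" | j u' v' where "0 < j" "j < length Rs" "ear_at Rs j u' v'"
      "e \<in> arcs (Rs ! j)" "head (Rs ! j) e = v'"
      by (auto simp: terminal_edges_def)
    then show "head R e = v"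
    proof cases
      case 1
      have "0 < length Rs" using i by linarith
      with 1 show ?thesis using e i ear_disjoint[of 0 i e] False by blast
    next
      case 2
      with e i ear_disjoint[of i j e] unique show ?thesis by auto
    qed
  next
    assume "head R e = v"
    then have "0 < i \<and> i < length Rs \<and> ear_at Rs i u v \<and> e \<in> arcs (Rs ! i) \<and> head (Rs ! i) e = v"
      using uv e i False by simp
    then show "e \<in> terminal_edges Rs r" unfolding terminal_edges_def by blast
  qed
  moreover have "previous i = (\<Union>j<i. verts (Rs ! j))"
    using root False by (auto simp: previous_def)
  ultimately show ?thesis using that[of u v] uv by (auto simp: ear_at_def)
qed

lemma head_new:
  assumes i: "i < length Rs" and e: "e \<in> arcs (Rs ! i)" "e \<notin> terminal_edges Rs r"
  shows "head R e \<notin> previous i"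
proof
  assume h: "head R e \<in> previous i"
  from i e(1) obtain u v where uv: "path_quiver (Rs ! i) u v"
    "verts (Rs ! i) \<inter> previous i = {u, v}"
    "\<And>e. e \<in> arcs (Rs ! i) \<Longrightarrow> e \<in> terminal_edges Rs r \<longleftrightarrow> head R e = v"
    by (auto elim: ear_target)
  with e ear_wf[OF i e(1)] h have "head R e = u" "u \<noteq> v" by auto
  moreover obtain p where "pre_digraph.cas (Rs ! i) u p v" "distinct (map (tail (Rs ! i)) p)"
    "p \<noteq> []" "arcs (Rs ! i) = set p"
    using uv(1) by (auto simp: path_quiver_def qpath_def pre_digraph.awalk_def)
  note p = this
  have "set (map (head (Rs ! i)) p) \<subseteq> set (tl (map (tail (Rs ! i)) p)) \<union> {v}"
    unfolding cas_heads(1)[OF p(1,3)] by auto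
  moreover have "u \<notin> set (tl (map (tail (Rs ! i)) p))"
    using cas_heads(2)[OF p(1,3)] p(2,3) by (cases p) auto
  ultimately show False using e(1) p(4) i \<open>u \<noteq> v\<close> by auto
qed

lemma previous_mono: "i < j \<Longrightarrow> verts (Rs ! i) \<subseteq> previous j"
  by (auto simp: previous_def)

lemma arc_in_ear:
  assumes "e \<in> arcs R"
  obtains i where "i < length Rs" "e \<in> arcs (Rs ! i)"
  using ears assms unfolding ear_decomposition_def by blast

lemma inj_on_head_ear_tree: "inj_on (head R) (arcs R - terminal_edges Rs r)"
proof (rule inj_onI)
  fix e e'
  assume e: "e \<in> arcs R - terminal_edges Rs r" "e' \<in> arcs R - terminal_edges Rs r"
    and eq: "head R e = head R e'"
  obtain i where i: "i < length Rs" "e \<in> arcs (Rs ! i)" using e arc_in_ear by blast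
  obtain j where j: "j < length Rs" "e' \<in> arcs (Rs ! j)" using e arc_in_ear by blast
  have "i = j"
  proof (rule ccontr)
    assume "i \<noteq> j"
    then consider "i < j" | "j < i" by linarith
    then show False
      using head_new[OF i] head_new[OF j] ear_wf[OF i] ear_wf[OF j] previous_mono[of i j]
        previous_mono[of j i] e eq by cases auto
  qed
  moreover have "arcs (Rs ! i) \<noteq> {}" using i by auto
  then obtain u v where "path_quiver (Rs ! i) u v" using ear_target[OF i(1)] by metis
  then have "inj_on (head R) (arcs (Rs ! i))" using path_quiver_inj_head i by fastforce
  ultimately show "e = e'" using i j eq by (auto dest: inj_onD)
qed

text \<open>
  By induction on the index of the ear: its source is reachable through earlier ears, and the
  nonterminal arcs then reach all its other vertices one after the other.
\<close>

lemma reachable_ear_tree: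
  assumes "v \<in> verts R"
  shows "(r, v) \<in> (arcs_ends (ear_tree R Rs r))\<^sup>*"
proof -
  let ?X = "{v. (r, v) \<in> (arcs_ends (ear_tree R Rs r))\<^sup>*}"
  have "verts (Rs ! i) \<subseteq> ?X" if "i < length Rs" for i
    using that
  proof (induction i rule: less_induct)
    case (less i)
    then have prev: "previous i \<subseteq> ?X" by (auto simp: previous_def)
    show ?case
    proof (cases "arcs (Rs ! i) = {}")
      case True
      \<comment> \<open>only the first ear can be a single vertex\<close>
      have "i = 0"
        using ears True less.prems path_quiver_source
        unfolding ear_decomposition_def ear_at_def by (metis empty_iff gr0I)
      moreover have "verts (Rs ! 0) = {r}"
        using ears True root \<open>i = 0\<close> path_quiver_source
        unfolding ear_decomposition_def by (metis empty_iff singletonD)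
      ultimately show ?thesis using prev by (auto simp: previous_def)
    next
      case False
      obtain u v where uv: "path_quiver (Rs ! i) u v"
        "verts (Rs ! i) \<inter> previous i = {u, v}"
        "\<And>e. e \<in> arcs (Rs ! i) \<Longrightarrow> e \<in> terminal_edges Rs r \<longleftrightarrow> head R e = v"
        by (rule ear_target[OF less.prems False]) (rule that)
      obtain p where p: "pre_digraph.cas (Rs ! i) u p v" "arcs (Rs ! i) = set p"
          "verts (Rs ! i) = tail (Rs ! i) ` set p \<union> head (Rs ! i) ` set p"
        using uv(1) by (auto simp: path_quiver_def qpath_def pre_digraph.awalk_def)
      have "arcs (Rs ! i) \<subseteq> arcs R"
        using ears less.prems by (auto simp: ear_decomposition_def subgraph_def)
      then have "head R e \<in> ?X" if "e \<in> set p" "tail R e \<in> ?X" "head R e \<noteq> v" for e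
        using that uv(3)[of e] p(2) by (auto simp: arcs_ends_conv intro: rtrancl_into_rtrancl)
      then show ?thesis unfolding p(3)
        using closed_along_walk[OF p(1), of ?X] uv(2) prev less.prems by auto
    qed
  qed
  moreover have "v \<in> (\<Union>i<length Rs. verts (Rs ! i))"
    using ears assms unfolding ear_decomposition_def by simp
  ultimately show ?thesis by auto
qed

lemma ear_tree_arborescence:
  "acyclic (arcs_ends (ear_tree R Rs r))" "arborescence (ear_tree R Rs r) r"
proof -
  have "r \<in> verts R"
    using ears root unfolding ear_decomposition_def by (auto simp: subgraph_def)
  moreover have "head R e \<noteq> r" if "e \<in> arcs R - terminal_edges Rs r" for e
    using that arc_in_ear[of e] head_new[of _ e] by (metis DiffD1 DiffD2 insertI1 previous_def)
  moreover have "wf_digraph (ear_tree R Rs r)" by unfold_locales auto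
  ultimately show "acyclic (arcs_ends (ear_tree R Rs r))" "arborescence (ear_tree R Rs r) r"
    using arborescence_if_unique_in_arc[of "ear_tree R Rs r" r] inj_on_head_ear_tree
      reachable_ear_tree by auto
qed

end

section \<open>Maximal strongly connected subquivers\<close>

text \<open>
  The vertices lying on a common closed walk with \<open>x\<close>.  Using walks with at least one arc makes
  this set empty if \<open>x\<close> lies on no cycle, in accordance with \<^const>\<open>qstrongly_connected\<close>.
\<close>

definition (in pre_digraph) scc_verts :: "'a \<Rightarrow> 'a set" where
  "scc_verts x = {y. x \<rightarrow>\<^sup>+ y \<and> y \<rightarrow>\<^sup>+ x}"

lemma (in wf_digraph) qstrongly_connected_iff:
  "qstrongly_connected G \<longleftrightarrow> verts G \<noteq> {} \<and> (\<forall>u\<in>verts G. \<forall>v\<in>verts G. u \<rightarrow>\<^sup>+ v)"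
  by (simp add: qstrongly_connected_def ex_qpath_iff_reachable1)

text \<open>
  A walk that starts and ends in the class of \<open>x\<close> cannot leave it.  The walk may use only a part of the
  arcs: this is what confines a cycle of the acyclic reduction to a single ear tree.
\<close>

lemma (in wf_digraph) trancl_within_scc:
  assumes H: "wf_digraph H" "arcs H \<subseteq> arcs G" "tail H = tail G" "head H = head G"
    and "(y, z) \<in> (arcs_ends H)\<^sup>+" and "x \<rightarrow>\<^sup>+ y" and "z \<rightarrow>\<^sup>+ x"
  shows "(y, z) \<in> (arcs_ends (H \<restriction> scc_verts x))\<^sup>+"
proof -
  have sub: "arcs_ends H \<subseteq> arcs_ends G"
    unfolding arcs_ends_conv H(3,4) using H(2) by (rule image_mono)
  have arc: "(a, b) \<in> arcs_ends (H \<restriction> scc_verts x)"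
    if "(a, b) \<in> arcs_ends H" "a \<in> scc_verts x" "b \<in> scc_verts x" for a b
    using that unfolding arcs_ends_conv by auto
  have z: "x \<rightarrow>\<^sup>+ z"
    using assms(6) trancl_mono[OF assms(5) sub] by (rule trancl_trans)
  show ?thesis
    using assms(5,6)
  proof (induction rule: converse_trancl_induct)
    case (base y)
    moreover from base have "y \<rightarrow>\<^sup>+ x" using sub assms(7) by (meson subsetD trancl_into_trancl2)
    ultimately show ?case using z assms(7) arc by (auto simp: scc_verts_def)
  next
    case (step a b)
    then have ab: "(a, b) \<in> arcs_ends G" "b \<rightarrow>\<^sup>+ z"
      using sub trancl_mono[OF step.hyps(2) sub] by auto
    then have xb: "x \<rightarrow>\<^sup>+ b" and bx: "b \<rightarrow>\<^sup>+ x"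
      using step.prems assms(7) by (auto intro: trancl_into_trancl)
    moreover have "a \<rightarrow>\<^sup>+ x" using ab bx by (auto intro: trancl_into_trancl2)
    ultimately have "(a, b) \<in> arcs_ends (H \<restriction> scc_verts x)"
      using arc[OF step.hyps(1)] step.prems by (auto simp: scc_verts_def)
    then show ?case using step.IH[OF xb] by (rule trancl_into_trancl2)
  qed
qed

lemma (in wf_digraph) scc_subgraph: "subgraph (G \<restriction> scc_verts x) G"
proof (rule subgraphI)
  show "verts (G \<restriction> scc_verts x) \<subseteq> verts G"
    using reachable1_in_verts by (auto simp: scc_verts_def)
qed (auto intro: compatible_induce_subgraph[unfolded compatible_def] wf_digraph simp: compatible_def)

lemma (in wf_digraph) scc_qstrongly_connected:
  assumes "x \<rightarrow>\<^sup>+ x"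
  shows "qstrongly_connected (G \<restriction> scc_verts x)"
proof -
  interpret S: wf_digraph "G \<restriction> scc_verts x" by (rule wellformed_induce_subgraph)
  have "(u, v) \<in> (arcs_ends (G \<restriction> scc_verts x))\<^sup>+"
    if "u \<in> scc_verts x" "v \<in> scc_verts x" for u v
  proof (rule trancl_within_scc)
    show "x \<rightarrow>\<^sup>+ u" "v \<rightarrow>\<^sup>+ x" using that by (simp_all add: scc_verts_def)
    show "u \<rightarrow>\<^sup>+ v" using that by (auto simp: scc_verts_def intro: trancl_trans)
  qed (rule order.refl refl wf_digraph)+
  then show ?thesis
    unfolding S.qstrongly_connected_iff using assms by (auto simp: scc_verts_def)
qed

lemma (in wf_digraph) qstrongly_connected_subgraph_scc:
  assumes H: "subgraph H G" "qstrongly_connected H" and x: "x \<in> verts H"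
  shows "subgraph H (G \<restriction> scc_verts x)" and "x \<rightarrow>\<^sup>+ x"
proof -
  have ends: "tail H = tail G" "head H = head G" "arcs H \<subseteq> arcs G" "wf_digraph H"
    using H(1) by (simp_all add: subgraph_def compatible_def)
  interpret H: wf_digraph H by (rule ends(4))
  have conn: "u \<rightarrow>\<^sup>+ v" if "u \<in> verts H" "v \<in> verts H" for u v
  proof -
    have "(u, v) \<in> (arcs_ends H)\<^sup>+" using H(2) that unfolding H.qstrongly_connected_iff by blast
    then show ?thesis using arcs_ends_mono[OF H(1)] by (rule trancl_mono)
  qed
  then show "x \<rightarrow>\<^sup>+ x" using x by blast
  have "verts H \<subseteq> scc_verts x" using x conn unfolding scc_verts_def by blast
  moreover from this have "arcs H \<subseteq> arcs (G \<restriction> scc_verts x)"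
    using ends(3) H.tail_in_verts H.head_in_verts unfolding ends(1,2) by auto
  ultimately show "subgraph H (G \<restriction> scc_verts x)"
    using ends wellformed_induce_subgraph by (simp add: subgraph_def compatible_def)
qed

text \<open>
  A maximal strongly connected subquiver is determined by any of its vertices; in particular two of
  them never share a vertex.
\<close>

lemma (in wf_digraph) MSC_eq_scc:
  assumes R: "R \<in> MSC G" and x: "x \<in> verts R"
  shows "R = G \<restriction> scc_verts x"
proof (rule ccontr)
  assume ne: "R \<noteq> G \<restriction> scc_verts x"
  from R have "subgraph R G" "qstrongly_connected R" by (simp_all add: MSC_def max_subgraph_def)
  note sub = qstrongly_connected_subgraph_scc[OF this x]
  show False
    using R ne sub(1) scc_subgraph scc_qstrongly_connected[OF sub(2)]
    unfolding MSC_def max_subgraph_def by auto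
qed

lemma (in wf_digraph) scc_in_MSC:
  assumes "x \<rightarrow>\<^sup>+ x"
  shows "G \<restriction> scc_verts x \<in> MSC G"
proof -
  have "H = G \<restriction> scc_verts x"
    if sub: "subgraph (G \<restriction> scc_verts x) H" and H: "subgraph H G" "qstrongly_connected H" for H
  proof -
    have "x \<in> scc_verts x" using assms by (simp add: scc_verts_def)
    then have "x \<in> verts H" using sub by (auto simp: subgraph_def)
    with H have "subgraph H (G \<restriction> scc_verts x)" by (intro qstrongly_connected_subgraph_scc(1))
    with sub have "verts H = verts (G \<restriction> scc_verts x)" "arcs H = arcs (G \<restriction> scc_verts x)"
      "tail H = tail (G \<restriction> scc_verts x)" "head H = head (G \<restriction> scc_verts x)"
      unfolding subgraph_def compatible_def by blast+
    then show ?thesis by (intro pre_digraph.equality) simp_all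
  qed
  then show ?thesis
    using scc_subgraph scc_qstrongly_connected[OF assms]
    unfolding MSC_def max_subgraph_def by blast
qed

section \<open>The acyclic reduction\<close>

lemma (in rooted_ear_decomposition) terminal_edges_subset: "terminal_edges Rs r \<subseteq> arcs R"
proof -
  have "arcs (Rs ! i) \<subseteq> arcs R" if "i < length Rs" for i
    using ears that by (auto simp: ear_decomposition_def)
  moreover have "0 < length Rs" using ears by (auto simp: ear_decomposition_def)
  ultimately show ?thesis unfolding terminal_edges_def by blast
qed

lemma (in rooted_ear_decomposition) root_path_section:
  assumes "\<And>e. e \<in> arcs R - terminal_edges Rs r \<Longrightarrow> \<gamma> (head R e) = rep_map A e (\<gamma> (tail R e))"
    and "v \<in> verts R"
  shows "path_map A (root_path (ear_tree R Rs r) r v) (\<gamma> r) = \<gamma> v"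
  by (rule path_map_section[where G = "ear_tree R Rs r"])
    (use assms root_path_awalk[OF ear_tree_arborescence(2)] in auto)

locale ear_choice_quiver = fin_digraph Q for Q :: "('v, 'e) pre_digraph" +
  fixes ears :: "('v, 'e) pre_digraph \<Rightarrow> ('v, 'e) pre_digraph list"
    and rt :: "('v, 'e) pre_digraph \<Rightarrow> 'v"
  assumes ear_choice: "ear_choice Q ears rt"
begin

abbreviation Qred :: "('v, 'e) pre_digraph" where
  "Qred \<equiv> acyclic_reduction Q ears rt"

lemma Qred_simps [simp]:
  "verts Qred = verts Q" "tail Qred = tail Q" "head Qred = head Q"
  "arcs Qred = arcs Q - (\<Union>R\<in>MSC Q. terminal_edges (ears R) (rt R))"
  by (simp_all add: acyclic_reduction_def)

lemma fin_digraph_Qred: "fin_digraph Qred"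
  by unfold_locales auto

lemma MSC_subgraph:
  assumes "R \<in> MSC Q"
  shows "wf_digraph R" "verts R \<subseteq> verts Q" "arcs R \<subseteq> arcs Q" "tail R = tail Q" "head R = head Q"
  using assms by (auto simp: MSC_def max_subgraph_def subgraph_def compatible_def)

lemma MSC_rooted:
  assumes "R \<in> MSC Q"
  shows "rooted_ear_decomposition R (ears R) (rt R)"
  using assms ear_choice MSC_subgraph(1)[OF assms]
  by (auto simp: ear_choice_def rooted_ear_decomposition_def rooted_ear_decomposition_axioms_def)

lemma root_in_verts:
  assumes "R \<in> MSC Q"
  shows "rt R \<in> verts R"
  using rooted_ear_decomposition.ear_tree_arborescence(2)[OF MSC_rooted[OF assms]]
  by (simp add: arborescence_def)

lemma MSC_disjoint:
  assumes "R \<in> MSC Q" "R' \<in> MSC Q" "x \<in> verts R" "x \<in> verts R'"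
  shows "R = R'"
  using assms MSC_eq_scc by metis

lemma ear_tree_arcs_subset:
  assumes R: "R \<in> MSC Q"
  shows "arcs R - terminal_edges (ears R) (rt R) \<subseteq> arcs Qred"
proof
  fix e
  assume e: "e \<in> arcs R - terminal_edges (ears R) (rt R)"
  have "e \<notin> terminal_edges (ears R') (rt R')" if R': "R' \<in> MSC Q" for R'
  proof
    assume e': "e \<in> terminal_edges (ears R') (rt R')"
    then have "e \<in> arcs R'"
      using rooted_ear_decomposition.terminal_edges_subset[OF MSC_rooted[OF R']] by blast
    then have "tail Q e \<in> verts R'"
      using MSC_subgraph[OF R'] wf_digraph.tail_in_verts by fastforce
    moreover have "tail Q e \<in> verts R"
      using e MSC_subgraph[OF R] wf_digraph.tail_in_verts by fastforce
    ultimately have "R' = R" using MSC_disjoint R R' by blast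
    with e e' show False by blast
  qed
  then show "e \<in> arcs Qred" using e MSC_subgraph[OF R] by auto
qed

text \<open>
  A cycle of \<open>Q\<close> stays inside one maximal strongly connected subquiver.  If it avoided the
  terminal edges as well, it would be a cycle of an ear tree.
\<close>

lemma acyclic_Qred: "acyclic (arcs_ends Qred)"
  unfolding acyclic_def
proof (intro allI notI)
  fix x
  assume x: "(x, x) \<in> (arcs_ends Qred)\<^sup>+"
  have "arcs_ends Qred \<subseteq> arcs_ends Q" by (auto simp: arcs_ends_conv)
  with x have xQ: "(x, x) \<in> (arcs_ends Q)\<^sup>+" by (rule trancl_mono)
  let ?R = "Q \<restriction> scc_verts x"
  have R: "?R \<in> MSC Q" using xQ by (rule scc_in_MSC)
  have "(x, x) \<in> (arcs_ends (Qred \<restriction> scc_verts x))\<^sup>+"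
    using x xQ fin_digraph_Qred by (intro trancl_within_scc) (auto simp: fin_digraph_def)
  moreover have "arcs_ends (Qred \<restriction> scc_verts x) \<subseteq> arcs_ends (ear_tree ?R (ears ?R) (rt ?R))"
    using R by (auto simp: arcs_ends_conv)
  ultimately have "(x, x) \<in> (arcs_ends (ear_tree ?R (ears ?R) (rt ?R)))\<^sup>+" by (rule trancl_mono)
  then show False
    using rooted_ear_decomposition.ear_tree_arborescence(1)[OF MSC_rooted[OF R]]
    by (auto simp: acyclic_def)
qed

section \<open>The acyclification\<close>

lemma circ_space_root:
  assumes "R \<in> MSC Q"
  shows "circ_space Q ears rt A (rt R) = ear_space A R (ears R) (rt R)"
proof -
  have "(THE R'. R' \<in> MSC Q \<and> rt R = rt R') = R"
    using assms MSC_disjoint root_in_verts by (intro the_equality) (auto, metis)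
  then show ?thesis using assms by (auto simp: circ_space_def)
qed

lemma in_circ_space_iff:
  "x \<in> circ_space Q ears rt A v \<longleftrightarrow>
     x \<in> rep_space A v \<and> (\<forall>R\<in>MSC Q. v = rt R \<longrightarrow> x \<in> ear_space A R (ears R) (rt R))"
proof (cases "\<exists>R\<in>MSC Q. v = rt R")
  case True
  then obtain R where R: "R \<in> MSC Q" "v = rt R" by blast
  then have "R' = R" if "R' \<in> MSC Q" "v = rt R'" for R'
    using that MSC_disjoint root_in_verts by metis
  then show ?thesis using R circ_space_root[OF R(1), of A] by (auto simp: ear_space_def)
next
  case False
  then show ?thesis by (auto simp: circ_space_def)
qed

text \<open>
  This form also covers the case without cycles, where the quantification over \<open>R\<close> is void.
\<close>

lemma in_Lambda_iff:
  "x \<in> Lambda Q ears rt A v \<longleftrightarrow> x \<in> circ_space Q ears rt A v \<and>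
     (\<forall>R\<in>MSC Q. \<forall>p. qpath Qred v p (rt R) \<longrightarrow> path_map A p x \<in> ear_space A R (ears R) (rt R))"
  by (cases "MSC Q = {}") (auto simp: Lambda_def Lambda_comp_def in_circ_space_iff)

text \<open>
  A path \<open>p\<close> from the target of \<open>e\<close> to a root extends to the walk \<open>e # p\<close>.  Acyclicity of the reduction
  guarantees that this is a path again, to which the condition on \<open>x\<close> applies.
\<close>

lemma Lambda_invariant:
  assumes e: "e \<in> arcs Qred" and x: "x \<in> Lambda Q ears rt A (tail Q e)"
    and A: "rep_map A e ` rep_space A (tail Q e) \<subseteq> rep_space A (head Q e)"
  shows "rep_map A e x \<in> Lambda Q ears rt A (head Q e)"
proof -
  interpret Qred: fin_digraph Qred by (rule fin_digraph_Qred)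
  have maps: "path_map A p x \<in> ear_space A R (ears R) (rt R)"
    if "R \<in> MSC Q" "Qred.awalk (tail Q e) p (rt R)" "p \<noteq> []" for R p
    using that x Qred.distinct_tails_if_acyclic[OF acyclic_Qred]
    by (auto simp: in_Lambda_iff qpath_def)
  have "rep_map A e x \<in> ear_space A R (ears R) (rt R)" if "R \<in> MSC Q" "head Q e = rt R" for R
    using maps[of R "[e]"] that e root_in_verts[OF that(1)] MSC_subgraph(2)[OF that(1)]
    by (auto simp: Qred.awalk_Cons_iff Qred.awalk_Nil_iff)
  moreover have "path_map A p (rep_map A e x) \<in> ear_space A R (ears R) (rt R)"
    if "R \<in> MSC Q" "qpath Qred (head Q e) p (rt R)" for R p
    using maps[of R "e # p"] that e by (auto simp: Qred.awalk_Cons_iff qpath_def)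
  moreover have "rep_map A e x \<in> rep_space A (head Q e)"
    using A x by (auto simp: in_Lambda_iff in_circ_space_iff)
  ultimately show ?thesis by (auto simp: in_Lambda_iff in_circ_space_iff)
qed

text \<open>
  The compatibility along a terminal edge says exactly that the value at the root lies in the ear
  space, once the values at its two ends are written as transports of the value at the root.  The
  remaining conditions in \<^const>\<open>Lambda\<close> hold for sections because transport along a path ending at
  a root yields the value there.
\<close>

lemma rep_sections_acyclification:
  "rep_sections Qred (acyclification Q ears rt A) = rep_sections Q A"
proof (intro set_eqI iffI)
  fix \<gamma>
  assume "\<gamma> \<in> rep_sections Qred (acyclification Q ears rt A)"
  then have \<gamma>: "\<And>v. v \<in> verts Q \<Longrightarrow> \<gamma> v \<in> Lambda Q ears rt A v" "\<And>v. v \<notin> verts Q \<Longrightarrow> \<gamma> v = 0"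
    "\<And>e. e \<in> arcs Qred \<Longrightarrow> \<gamma> (head Q e) = rep_map A e (\<gamma> (tail Q e))"
    by (auto simp: rep_sections_def Tot_def prod_space_def acyclification_def)
  have "\<gamma> (head Q e) = rep_map A e (\<gamma> (tail Q e))"
    if R: "R \<in> MSC Q" and e: "e \<in> terminal_edges (ears R) (rt R)" for e R
  proof -
    interpret R: rooted_ear_decomposition R "ears R" "rt R" using R by (rule MSC_rooted)
    have eR: "e \<in> arcs R" using e R.terminal_edges_subset by blast
    have path: "path_map A (root_path (ear_tree R (ears R) (rt R)) (rt R) v) (\<gamma> (rt R)) = \<gamma> v"
      if "v \<in> verts R" for v
      using that \<gamma>(3) ear_tree_arcs_subset[OF R] MSC_subgraph[OF R]
      by (intro R.root_path_section) auto
    have "\<gamma> (rt R) \<in> ear_space A R (ears R) (rt R)"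
      using \<gamma>(1)[of "rt R"] root_in_verts[OF R] MSC_subgraph(2)[OF R] R
      by (auto simp: in_Lambda_iff in_circ_space_iff)
    with e have "path_map A (root_path (ear_tree R (ears R) (rt R)) (rt R) (head R e)) (\<gamma> (rt R))
       = rep_map A e
           (path_map A (root_path (ear_tree R (ears R) (rt R)) (rt R) (tail R e)) (\<gamma> (rt R)))"
      by (auto simp: ear_space_def)
    then show ?thesis using path[of "head R e"] path[of "tail R e"] eR R.tail_in_verts[OF eR]
        R.head_in_verts[OF eR] unfolding MSC_subgraph(4,5)[OF R] by simp
  qed
  with \<gamma> have "\<gamma> (head Q e) = rep_map A e (\<gamma> (tail Q e))" if "e \<in> arcs Q" for e
    using that by (cases "e \<in> arcs Qred") auto
  with \<gamma> show "\<gamma> \<in> rep_sections Q A"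
    by (auto simp: rep_sections_def Tot_def prod_space_def in_Lambda_iff in_circ_space_iff)
next
  fix \<gamma>
  assume "\<gamma> \<in> rep_sections Q A"
  then have \<gamma>: "\<And>v. v \<in> verts Q \<Longrightarrow> \<gamma> v \<in> rep_space A v" "\<And>v. v \<notin> verts Q \<Longrightarrow> \<gamma> v = 0"
    "\<And>e. e \<in> arcs Q \<Longrightarrow> \<gamma> (head Q e) = rep_map A e (\<gamma> (tail Q e))"
    by (auto simp: rep_sections_def Tot_def prod_space_def)
  have ear: "\<gamma> (rt R) \<in> ear_space A R (ears R) (rt R)" if R: "R \<in> MSC Q" for R
  proof -
    interpret R: rooted_ear_decomposition R "ears R" "rt R" using R by (rule MSC_rooted)
    have path: "path_map A (root_path (ear_tree R (ears R) (rt R)) (rt R) v) (\<gamma> (rt R)) = \<gamma> v"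
      if "v \<in> verts R" for v
      using that \<gamma>(3) MSC_subgraph[OF R] by (intro R.root_path_section) auto
    have "e \<in> arcs Q \<and> tail Q e \<in> verts R \<and> head Q e \<in> verts R"
      if "e \<in> terminal_edges (ears R) (rt R)" for e
    proof -
      have "e \<in> arcs R" using that R.terminal_edges_subset by blast
      then show ?thesis
        using R.tail_in_verts R.head_in_verts MSC_subgraph[OF R] by auto
    qed
    then show ?thesis
      using path \<gamma> root_in_verts[OF R] MSC_subgraph[OF R] by (auto simp: ear_space_def)
  qed
  have "path_map A p (\<gamma> v) = \<gamma> w" if "qpath Qred v p w" for v p w
    using that \<gamma>(3) by (intro path_map_section[where G = Qred]) (auto simp: qpath_def)
  with \<gamma> ear show "\<gamma> \<in> rep_sections Qred (acyclification Q ears rt A)"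
    by (auto simp: rep_sections_def Tot_def prod_space_def acyclification_def in_Lambda_iff
        in_circ_space_iff)
qed

end

section \<open>Flow spaces of acyclic quivers\<close>

lemma augment_simps [simp]:
  "verts (augment P) = insert None (Some ` verts P)"
  "arcs (augment P) = Inl ` arcs P \<union> Inr ` min_verts P"
  "tail (augment P) (Inl e) = Some (tail P e)" "tail (augment P) (Inr v) = None"
  "head (augment P) (Inl e) = Some (head P e)" "head (augment P) (Inr v) = Some v"
  by (simp_all add: augment_def)

lemma augment_rep_simps [simp]:
  "rep_space (augment_rep P B) None = prod_space (min_verts P) (rep_space B) \<times> {0}"
  "rep_space (augment_rep P B) (Some v) = {0} \<times> rep_space B v"
  "rep_map (augment_rep P B) (Inl e) z = (0, rep_map B e (snd z))"
  "rep_map (augment_rep P B) (Inr v) z = (0, fst z v)"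
  by (simp_all add: augment_rep_def)

text \<open>
  The value at the new vertex of the only extension of a section of \<open>P\<close> to the augmented quiver.
\<close>

definition root_values :: "('v, 'e) pre_digraph \<Rightarrow> ('v \<Rightarrow> 'b::zero) \<Rightarrow> ('v \<Rightarrow> 'b) \<times> 'b" where
  "root_values P \<gamma> = ((\<lambda>v. if v \<in> min_verts P then \<gamma> v else 0), 0)"

definition augmented_section ::
    "('v, 'e) pre_digraph \<Rightarrow> ('v \<Rightarrow> 'b::zero) \<Rightarrow> 'v option \<Rightarrow> ('v \<Rightarrow> 'b) \<times> 'b" where
  "augmented_section P \<gamma> = case_option (root_values P \<gamma>) (\<lambda>v. (0, \<gamma> v))"

lemma augmented_section:
  assumes "\<gamma> \<in> rep_sections P B" and "e \<in> arcs (augment P)"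
  shows "augmented_section P \<gamma> (head (augment P) e) =
    rep_map (augment_rep P B) e (augmented_section P \<gamma> (tail (augment P) e))"
  using assms by (auto simp: augmented_section_def root_values_def rep_sections_def)

lemma trancl_augment_None: "(w, None) \<notin> (arcs_ends (augment P))\<^sup>+"
proof
  assume "(w, None) \<in> (arcs_ends (augment P))\<^sup>+"
  then obtain w' where "(w', None) \<in> arcs_ends (augment P)" by (auto elim: tranclE)
  then show False by (auto simp: arcs_ends_conv)
qed

lemma wf_augment:
  assumes fin: "fin_digraph P" and ac: "acyclic (arcs_ends P)"
  shows "wf (arcs_ends (augment P))"
proof -
  interpret fin_digraph P by (rule fin)
  have "finite (min_verts P)" by (simp add: min_verts_def)
  then have "finite (arcs_ends (augment P))" by (simp add: arcs_ends_conv)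
  moreover have "(u, v) \<in> (arcs_ends P)\<^sup>+" if "(Some u, w) \<in> (arcs_ends (augment P))\<^sup>+" "w = Some v"
    for u v w
    using that
  proof (induction arbitrary: v rule: trancl_induct)
    case (base w)
    then show ?case by (auto simp: arcs_ends_conv)
  next
    case (step y w)
    from step.hyps(1) obtain v' where "y = Some v'" using trancl_augment_None by (cases y) auto
    with step have "(u, v') \<in> (arcs_ends P)\<^sup>+" "(v', v) \<in> arcs_ends P" by (auto simp: arcs_ends_conv)
    then show ?case by (rule trancl_into_trancl)
  qed
  then have "acyclic (arcs_ends (augment P))"
    using ac trancl_augment_None unfolding acyclic_def by (metis option.exhaust)
  ultimately show ?thesis by (rule finite_acyclic_wf)
qed

text \<open>
  On such a quiver the recursion for the flow maps is well-founded.  Its solution at a point \<open>x\<close> of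
  the flow space is a section with root value \<open>x\<close>, so that the flow space is a copy of the space of
  sections.
\<close>

locale finite_acyclic_quiver = fin_digraph P for P :: "('v, 'e) pre_digraph" +
  assumes acyclic: "acyclic (arcs_ends P)"
begin

lemma in_arcs_augment_nonempty:
  assumes "v \<in> verts P"
  shows "in_arcs (augment P) (Some v) \<noteq> {}"
proof (cases "v \<in> min_verts P")
  case True
  then have "Inr v \<in> in_arcs (augment P) (Some v)" by (simp add: in_arcs_def)
  then show ?thesis by blast
next
  case False
  with assms obtain e where "e \<in> arcs P" "head P e = v" by (auto simp: min_verts_def)
  then have "Inl e \<in> in_arcs (augment P) (Some v)" by (simp add: in_arcs_def)
  then show ?thesis by blast
qed

lemma flow_None: "flow P B None = (rep_space (augment_rep P B) None, id)"
  unfolding flow_def by (subst wfrec[OF wf_augment[OF fin_digraph_axioms acyclic]]) simp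

lemma flow_Some:
  fixes B :: "('v, 'e, 'b::ab_group_add) quiver_rep" and v :: 'v
  defines "I \<equiv> in_arcs (augment P) (Some v)"
    and "val \<equiv> \<lambda>e x. rep_map (augment_rep P B) e (snd (flow P B (tail (augment P) e)) x)"
  shows "flow P B (Some v) =
    ({x \<in> \<Inter>e\<in>I. fst (flow P B (tail (augment P) e)). \<forall>e\<in>I. \<forall>e'\<in>I. val e x = val e' x},
     \<lambda>x. THE y. \<forall>e\<in>I. val e x = y)"
proof -
  have cut: "cut f (arcs_ends (augment P)) (Some v) (tail (augment P) e) = f (tail (augment P) e)"
    if "e \<in> I" for e f
    using that by (intro cut_apply) (force simp: I_def in_arcs_def arcs_ends_conv)
  show ?thesis
    unfolding flow_def
    apply (subst wfrec[OF wf_augment[OF fin_digraph_axioms acyclic]])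
    apply (simp add: Let_def flip: I_def flow_def)
    apply (simp add: cut val_def cong: INF_cong ball_cong)
    done
qed

lemma flow_SomeD:
  assumes "x \<in> fst (flow P B (Some v))" and e: "e \<in> in_arcs (augment P) (Some v)"
  shows "snd (flow P B (Some v)) x =
    rep_map (augment_rep P B) e (snd (flow P B (tail (augment P) e)) x)"
proof -
  have "snd (flow P B (Some v)) x = (THE y. \<forall>e\<in>in_arcs (augment P) (Some v).
      rep_map (augment_rep P B) e (snd (flow P B (tail (augment P) e)) x) = y)"
    by (subst flow_Some) simp
  also have "\<dots> = rep_map (augment_rep P B) e (snd (flow P B (tail (augment P) e)) x)"
  proof (rule the_equality)
    show "\<forall>e'\<in>in_arcs (augment P) (Some v).
      rep_map (augment_rep P B) e' (snd (flow P B (tail (augment P) e')) x) =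
      rep_map (augment_rep P B) e (snd (flow P B (tail (augment P) e)) x)"
      using assms(1)[unfolded flow_Some fst_conv mem_Collect_eq] e by blast
  next
    fix y
    assume "\<forall>e\<in>in_arcs (augment P) (Some v).
      rep_map (augment_rep P B) e (snd (flow P B (tail (augment P) e)) x) = y"
    from this[rule_format, OF e]
    show "y = rep_map (augment_rep P B) e (snd (flow P B (tail (augment P) e)) x)" by (rule sym)
  qed
  finally show ?thesis .
qed

text \<open>
  The existence of an incoming arc, possibly a new one, forces the common value to be \<open>y\<close>.
\<close>

lemma flow_SomeI:
  assumes "v \<in> verts P"
    and "\<And>e. e \<in> in_arcs (augment P) (Some v) \<Longrightarrow> x \<in> fst (flow P B (tail (augment P) e)) \<and>
       rep_map (augment_rep P B) e (snd (flow P B (tail (augment P) e)) x) = y"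
  shows "x \<in> fst (flow P B (Some v))" and "snd (flow P B (Some v)) x = y"
proof -
  show 1: "x \<in> fst (flow P B (Some v))"
    using assms(2) by (subst flow_Some) (simp del: in_in_arcs_conv)
  from in_arcs_augment_nonempty[OF assms(1)] obtain e where
    e: "e \<in> in_arcs (augment P) (Some v)" by blast
  show "snd (flow P B (Some v)) x = y" using flow_SomeD[OF 1 e] assms(2)[OF e] by simp
qed

lemma flow_section:
  assumes \<gamma>: "\<gamma> \<in> rep_sections P B" and "w \<in> verts (augment P)"
  shows "root_values P \<gamma> \<in> fst (flow P B w) \<and>
    snd (flow P B w) (root_values P \<gamma>) = augmented_section P \<gamma> w"
  using assms(2)
proof (induction w rule: wf_induct_rule[OF wf_augment[OF fin_digraph_axioms acyclic]])
  case (1 w)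
  show ?case
  proof (cases w)
    case None
    have "root_values P \<gamma> \<in> rep_space (augment_rep P B) None"
      using \<gamma> by (auto simp: root_values_def rep_sections_def Tot_def prod_space_def min_verts_def)
    with None show ?thesis by (simp add: flow_None augmented_section_def)
  next
    case (Some v)
    with 1 have v: "v \<in> verts P" by auto
    have "root_values P \<gamma> \<in> fst (flow P B (tail (augment P) e)) \<and>
       rep_map (augment_rep P B) e (snd (flow P B (tail (augment P) e)) (root_values P \<gamma>))
         = augmented_section P \<gamma> (Some v)"
      if e: "e \<in> in_arcs (augment P) (Some v)" for e
    proof -
      have "(tail (augment P) e, w) \<in> arcs_ends (augment P)"
        using e Some by (force simp: in_arcs_def arcs_ends_conv)
      moreover have "tail (augment P) e \<in> verts (augment P)"
        using e by (auto simp: in_arcs_def)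
      ultimately have "root_values P \<gamma> \<in> fst (flow P B (tail (augment P) e)) \<and>
        snd (flow P B (tail (augment P) e)) (root_values P \<gamma>) =
          augmented_section P \<gamma> (tail (augment P) e)"
        by (rule "1.IH")
      with augmented_section[OF \<gamma>, of e] e show ?thesis by (auto simp: in_arcs_def)
    qed
    from flow_SomeI[OF v this] Some show ?thesis by simp
  qed
qed

text \<open>
  The values of the flow maps at \<open>x\<close> form the section.  That they lie in the spaces of \<open>B\<close> follows by
  induction along the arcs, starting from the minimal vertices, where they are components of \<open>x\<close>.
\<close>

lemma flow_space_section:
  assumes B: "\<And>e. e \<in> arcs P \<Longrightarrow> rep_map B e ` rep_space B (tail P e) \<subseteq> rep_space B (head P e)"
    and x: "x \<in> flow_space P B"
  shows "\<exists>\<gamma>\<in>rep_sections P B. x = root_values P \<gamma>"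
proof
  let ?\<gamma> = "\<lambda>v. if v \<in> verts P then snd (snd (flow P B (Some v)) x) else 0"
  have xv: "x \<in> fst (flow P B (Some v))" if "v \<in> verts P" for v
    using that x by (simp add: flow_space_def)
  have root: "fst x \<in> prod_space (min_verts P) (rep_space B)" "snd x = 0"
    using x by (auto simp: flow_space_def)
  have min: "snd (snd (flow P B (Some v)) x) = fst x v" if "v \<in> min_verts P" for v
  proof -
    have "v \<in> verts P" "Inr v \<in> in_arcs (augment P) (Some v)"
      using that by (auto simp: min_verts_def in_arcs_def)
    from flow_SomeD[OF xv[OF this(1)] this(2)] show ?thesis by (simp add: flow_None)
  qed
  have arc: "snd (snd (flow P B (Some (head P e))) x)
      = rep_map B e (snd (snd (flow P B (Some (tail P e))) x))" if "e \<in> arcs P" for e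
  proof -
    have "head P e \<in> verts P" "Inl e \<in> in_arcs (augment P) (Some (head P e))"
      using that by (auto simp: in_arcs_def)
    from flow_SomeD[OF xv[OF this(1)] this(2)] show ?thesis by simp
  qed
  have wfP: "wf (arcs_ends P)"
    using acyclic by (intro finite_acyclic_wf) (simp_all add: arcs_ends_conv)
  have "snd (snd (flow P B (Some v)) x) \<in> rep_space B v" if "v \<in> verts P" for v
    using that
  proof (induction v rule: wf_induct_rule[OF wfP])
    case (1 v)
    show ?case
    proof (cases "v \<in> min_verts P")
      case True
      with root min show ?thesis by (auto simp: prod_space_def)
    next
      case False
      with 1 obtain e where e: "e \<in> arcs P" "head P e = v" by (auto simp: min_verts_def)
      then have "snd (snd (flow P B (Some (tail P e))) x) \<in> rep_space B (tail P e)"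
        by (intro "1.IH") (auto simp: arcs_ends_conv)
      with B[OF e(1)] arc[OF e(1)] e show ?thesis by auto
    qed
  qed
  with arc show "?\<gamma> \<in> rep_sections P B"
    by (auto simp: rep_sections_def Tot_def prod_space_def)
  have "fst x v = (if v \<in> min_verts P then ?\<gamma> v else 0)" for v
    using root(1) min by (auto simp: prod_space_def min_verts_def)
  then show "x = root_values P ?\<gamma>"
    using root(2) by (auto simp: root_values_def prod_eq_iff fun_eq_iff)
qed

lemma flow_space_eq:
  assumes "\<And>e. e \<in> arcs P \<Longrightarrow> rep_map B e ` rep_space B (tail P e) \<subseteq> rep_space B (head P e)"
  shows "flow_space P B = root_values P ` rep_sections P B"
proof
  show "flow_space P B \<subseteq> root_values P ` rep_sections P B"
    using flow_space_section[OF assms] by blast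
  have "root_values P \<gamma> \<in> flow_space P B" if "\<gamma> \<in> rep_sections P B" for \<gamma>
  proof -
    have "root_values P \<gamma> \<in> fst (flow P B w)" if "w \<in> verts (augment P)" for w
      using flow_section[OF \<open>\<gamma> \<in> rep_sections P B\<close> that] by blast
    from this[of None] this show ?thesis by (simp add: flow_space_def flow_None)
  qed
  then show "root_values P ` rep_sections P B \<subseteq> flow_space P B" by blast
qed

end

section \<open>Sections from the arboreal replacement\<close>

text \<open>
  The map of the theorem is therefore the inverse of \<^const>\<open>root_values\<close> on sections.
\<close>

lemma spanning_arborescence_path_map:
  assumes T: "spanning_arborescence T (augment P) None" and \<gamma>: "\<gamma> \<in> rep_sections P B"
    and v: "v \<in> verts P"
  shows "path_map (arboreal_replacement P B) (root_path T None (Some v)) (root_values P \<gamma>)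
    = (0, \<gamma> v)"
proof -
  have T': "arborescence T None" "verts T = verts (augment P)" "arcs T \<subseteq> arcs (augment P)"
      "tail T = tail (augment P)" "head T = head (augment P)"
    using T by (auto simp: spanning_arborescence_def spanning_def subgraph_def compatible_def)
  have "path_map (augment_rep P B) (root_path T None (Some v)) (augmented_section P \<gamma> None)
    = augmented_section P \<gamma> (Some v)"
  proof (rule path_map_section[where G = T])
    show "pre_digraph.awalk T None (root_path T None (Some v)) (Some v)"
      using T' v by (intro root_path_awalk) auto
    show "\<forall>e\<in>arcs T. augmented_section P \<gamma> (head T e) =
        rep_map (augment_rep P B) e (augmented_section P \<gamma> (tail T e))"
      unfolding T'(4,5) using T'(3) augmented_section[OF \<gamma>] by blast
  qed
  then show ?thesis by (simp add: arboreal_replacement_def augmented_section_def)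
qed

lemma module_fun_scale: "module s \<Longrightarrow> module (fun_scale s)"
  by (simp add: module_def fun_scale_def fun_eq_iff)

lemma module_aug_scale: "module s \<Longrightarrow> module (aug_scale s)"
  by (simp add: module_def aug_scale_def fun_scale_def fun_eq_iff prod_eq_iff)

lemma subspace_rep_sections:
  assumes s: "vector_space s" and A: "representation s Q A" and "wf_digraph Q"
  shows "module.subspace (fun_scale s) (Tot Q A)"
    and "module.subspace (fun_scale s) (rep_sections Q A)"
proof -
  interpret vector_space s by (rule s)
  interpret Q: wf_digraph Q by fact
  interpret F: module "fun_scale s" by (rule module_fun_scale) (rule module_axioms)
  have sub: "subspace (rep_space A v)" if "v \<in> verts Q" for v
    using A that by (auto simp: Defs.representation_def)
  show Tot: "F.subspace (Tot Q A)"
    using sub by (intro F.subspaceI)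
      (auto simp: Tot_def prod_space_def fun_scale_def subspace_0 subspace_add subspace_scale)
  have lin: "linear_between s s (rep_space A (tail Q e)) (rep_space A (head Q e)) (rep_map A e)"
    if "e \<in> arcs Q" for e
    using A that by (simp add: Defs.representation_def)
  have mem: "\<gamma> (tail Q e) \<in> rep_space A (tail Q e)" if "e \<in> arcs Q" "\<gamma> \<in> Tot Q A" for e \<gamma>
    using that by (simp add: Tot_def prod_space_def)
  have "rep_map A e 0 = 0" if "e \<in> arcs Q" for e
  proof -
    have "0 \<in> rep_space A (tail Q e)" using sub[of "tail Q e"] that by (simp add: subspace_0)
    then have "rep_map A e (s 0 0) = s 0 (rep_map A e 0)"
      using lin[OF that] unfolding linear_between_def by blast
    then show ?thesis by simp
  qed
  then have "0 \<in> rep_sections Q A"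
    using F.subspace_0[OF Tot] by (simp add: rep_sections_def)
  moreover have "\<gamma> + \<delta> \<in> rep_sections Q A" if "\<gamma> \<in> rep_sections Q A" "\<delta> \<in> rep_sections Q A" for \<gamma> \<delta>
    using that F.subspace_add[OF Tot] lin mem
    by (auto simp: rep_sections_def linear_between_def)
  moreover have "fun_scale s c \<gamma> \<in> rep_sections Q A" if "\<gamma> \<in> rep_sections Q A" for c \<gamma>
    using that F.subspace_scale[OF Tot, of \<gamma> c] lin mem
    by (auto simp: rep_sections_def linear_between_def fun_scale_def)
  ultimately show "F.subspace (rep_sections Q A)" by (rule F.subspaceI)
qed

lemma root_values_add: "root_values P (\<gamma> + \<delta>) = root_values P \<gamma> + root_values P \<delta>"
  for \<gamma> \<delta> :: "'v \<Rightarrow> 'b::ab_group_add"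
  by (auto simp: root_values_def fun_eq_iff)

lemma root_values_scale:
  assumes "module s"
  shows "root_values P (fun_scale s c \<gamma>) = aug_scale s c (root_values P \<gamma>)"
  using assms by (auto simp: root_values_def aug_scale_def fun_scale_def fun_eq_iff
      module.scale_zero_right)

theorem mainTheorem1:
  fixes s :: "'k::field \<Rightarrow> 'b::ab_group_add \<Rightarrow> 'b"
    and Q Qstar :: "('v, 'e) pre_digraph"
    and A Astar :: "('v, 'e, 'b) quiver_rep"
    and ears :: "('v, 'e) pre_digraph \<Rightarrow> ('v, 'e) pre_digraph list"
    and rt :: "('v, 'e) pre_digraph \<Rightarrow> 'v"
    and Tplus :: "('v option, 'e + 'v) pre_digraph"
    and Aplus :: "('v option, 'e + 'v, ('v \<Rightarrow> 'b) \<times> 'b) quiver_rep"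
    and F :: "('v \<Rightarrow> 'b) \<times> 'b \<Rightarrow> 'v \<Rightarrow> 'b"
  assumes "vector_space s"
    and "fin_digraph Q"
    and "representation s Q A"
    and "ear_choice Q ears rt"
    and "Qstar = acyclic_reduction Q ears rt"
    and "Astar = acyclification Q ears rt A"
    and "spanning_arborescence Tplus (augment Qstar) None"
    and "Aplus = arboreal_replacement Qstar Astar"
    and "F = (\<lambda>x v. if v \<in> verts Q
                    then snd (path_map Aplus (root_path Tplus None (Some v)) x) else 0)"
  shows "linear_between (aug_scale s) (fun_scale s) (rep_space Aplus None) (Tot Q A) F \<and>
         (\<forall>x\<in>rep_space Aplus None. \<forall>v\<in>verts Q.
            path_map Aplus (root_path Tplus None (Some v)) x \<in> rep_space Aplus (Some v)) \<and>
         rep_sections Q A = F ` rep_space Aplus None"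
proof -
  let ?\<Gamma> = "rep_sections Q A"
  interpret vector_space s by fact
  interpret ear_choice_quiver Q ears rt
    using assms(2,4) by (simp add: ear_choice_quiver_def ear_choice_quiver_axioms_def)
  have Qstar: "Qstar = Qred" by fact
  interpret P: finite_acyclic_quiver Qstar
    unfolding Qstar using fin_digraph_Qred acyclic_Qred
    by (simp add: finite_acyclic_quiver_def finite_acyclic_quiver_axioms_def)
  have maps: "rep_map A e ` rep_space A (tail Q e) \<subseteq> rep_space A (head Q e)" if "e \<in> arcs Q" for e
    using assms(3) that by (simp add: Defs.representation_def linear_between_def)
  have \<Gamma>: "rep_sections Qstar Astar = ?\<Gamma>"
    using rep_sections_acyclification by (simp add: assms(5,6))
  have "flow_space Qstar Astar = root_values Qstar ` ?\<Gamma>"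
    unfolding \<Gamma>[symmetric]
  proof (rule P.flow_space_eq)
    fix e assume "e \<in> arcs Qstar"
    then show "rep_map Astar e ` rep_space Astar (tail Qstar e) \<subseteq> rep_space Astar (head Qstar e)"
      using Lambda_invariant[of e _ A] maps by (auto simp: assms(5,6) acyclification_def)
  qed
  then have root: "rep_space Aplus None = root_values Qstar ` ?\<Gamma>"
    by (simp add: assms(8) arboreal_replacement_def)
  have path: "path_map Aplus (root_path Tplus None (Some v)) (root_values Qstar \<gamma>) = (0, \<gamma> v)"
    if "\<gamma> \<in> ?\<Gamma>" "v \<in> verts Q" for \<gamma> v
    using spanning_arborescence_path_map[OF assms(7), of \<gamma> Astar v] that \<Gamma>
    by (simp add: assms(8) Qstar)
  \<comment> \<open>linearity of \<open>F\<close> is inherited from its inverse \<open>root_values\<close>\<close>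
  have F: "F (root_values Qstar \<gamma>) = \<gamma>" if "\<gamma> \<in> ?\<Gamma>" for \<gamma>
    using that path[OF that]
    by (auto simp: assms(9) fun_eq_iff rep_sections_def Tot_def prod_space_def)
  note sub = subspace_rep_sections[OF assms(1,3) wf_digraph_axioms]
  interpret FS: module "fun_scale s" by (rule module_fun_scale) (rule module_axioms)
  interpret AS: module "aug_scale s" by (rule module_aug_scale) (rule module_axioms)
  note add = root_values_add[of Qstar, symmetric]
    and scale = root_values_scale[OF module_axioms, of Qstar, symmetric]
  have \<Gamma>0: "0 \<in> ?\<Gamma>" and \<Gamma>add: "\<And>\<gamma> \<delta>. \<gamma> \<in> ?\<Gamma> \<Longrightarrow> \<delta> \<in> ?\<Gamma> \<Longrightarrow> \<gamma> + \<delta> \<in> ?\<Gamma>"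
    and \<Gamma>scale: "\<And>c \<gamma>. \<gamma> \<in> ?\<Gamma> \<Longrightarrow> fun_scale s c \<gamma> \<in> ?\<Gamma>"
    using sub(2) by (simp_all add: FS.subspace_def)
  have "root_values Qstar 0 = (0 :: ('v \<Rightarrow> 'b) \<times> 'b)"
    by (auto simp: root_values_def fun_eq_iff prod_eq_iff)
  then have "AS.subspace (rep_space Aplus None)"
    unfolding root using \<Gamma>0 \<Gamma>add \<Gamma>scale
    by (intro AS.subspaceI) (auto simp: add scale intro: rev_image_eqI)
  then have "linear_between (aug_scale s) (fun_scale s) (rep_space Aplus None) (Tot Q A) F"
    unfolding linear_between_def root using sub(1) F \<Gamma>add \<Gamma>scale
    by (auto simp: add scale rep_sections_def)
  moreover have "path_map Aplus (root_path Tplus None (Some v)) x \<in> rep_space Aplus (Some v)"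
    if x: "x \<in> rep_space Aplus None" and v: "v \<in> verts Q" for x v
  proof -
    from x obtain \<gamma> where \<gamma>: "\<gamma> \<in> ?\<Gamma>" "x = root_values Qstar \<gamma>" unfolding root by blast
    then have "\<gamma> v \<in> rep_space Astar v"
      using v \<Gamma> by (auto simp: rep_sections_def Tot_def prod_space_def Qstar)
    then show ?thesis using path[OF \<gamma>(1) v] \<gamma>(2) by (simp add: assms(8) arboreal_replacement_def)
  qed
  moreover have "?\<Gamma> = F ` rep_space Aplus None" unfolding root using F by (force simp: image_image)
  ultimately show ?thesis by blast
qed

end
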